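(* Let $\tau>0$, let $X$ be a Banach space, and let $C:=C([-\tau,0],X)$ with norm $\|\phi\|=\sup_{-\tau\le\theta\le 0}\|\phi(\theta)\|_X$. Let $A$ be the infinitesimal generator of a $C_0$-semigroup $\{T(t)\}_{t\ge 0}$ on $X$ such that $T(t)$ is compact for each $t>0$ and such that there exists $M>0$ with $\|T(t)\|\le M$ for all $t\ge 0$. Let $F:[0,\infty)\times C\to X$ be continuous and map bounded sets into bounded sets. Consider the abstract functional differential equation $$\frac{du(t)}{dt}=Au(t)+F(t,u_t),\quad t>0,\qquad u_0=\phi\in C,$$ where $u_t\in C$ is defined by $u_t(\theta)=u(t+\theta)$ for $\theta\in[-\tau,0]$. Assume that for each $\phi\in C$ this equation has a unique solution $u(t,\phi)$ on $[0,\infty)$, and that solutions are uniformly bounded in the sense that for any bounded subset $B_0$ of $C$ there exists a bounded subset $B_1=B_1(B_0)$ of $C$ such that $u_t(\phi)\in B_1$ for all $\phi\in B_0$ and $t\ge 0$. Then for any given $r>0$ there exists an equivalent norm $\|\cdot\|_r^*$ on $C$ such that the solution maps $Q(t):C\to C$, $Q(t)\phi:=u_t(\phi)$, satisfy $$\alpha(Q(t)B)\le e^{-rt}\alpha(B)$$ for any bounded subset $B$ of $C$ and any $t\ge 0$, where $\alpha$ is the Kuratowski measure of noncompactness in $(C,\|\cdot\|_r^* )$.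
   Context: For $\phi\in C$, $u(\cdot,\phi)$ denotes the solution with initial data $\phi$, and $u_t(\phi)\in C$ denotes the function $\theta\mapsto u(t+\theta,\phi)$, $\theta\in[-\tau,0]$ (with $u(\theta,\phi)=\phi(\theta)$ for $\theta\in[-\tau,0]$). Solutions are understood in the mild sense: a solution on $[0,\infty)$ with initial data $\phi$ is a continuous function $u:[-\tau,\infty)\to X$ with $u_0=\phi$ and $$u(t)=T(t)\phi(0)+\int_0^t T(t-s)F(s,u_s)\,ds,\quad t\ge 0.$$ The Kuratowski measure of noncompactness of a bounded subset $B$ of a normed space is $\alpha(B)=\inf\{d>0: B \text{ has a finite cover by sets of diameter at most } d\}$, with diameters measured in the indicated norm. A norm $\|\cdot\|_r^*$ on $C$ is equivalent to $\|\cdot\|$ if there are constants $c_1,c_2>0$ with $c_1\|\phi\|\le\|\phi\|_r^*\le c_2\|\phi\|$ for all $\phi\in C$. *)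

theory Defs
  imports "HOL-Analysis.Analysis"
begin

section \<open>The phase space\<close>

text \<open>
  A continuous function on \<open>[-\<tau>, 0]\<close> is represented by its extension to the real line that is
  constant on either side of the interval. This makes \<open>C([-\<tau>, 0], X)\<close> a closed subspace of the
  library type of bounded continuous functions, with the supremum norm as the norm of that type;
  see \<open>norm_C_space\<close> and \<open>bij_betw_restrict_C_space\<close>.
\<close>

definition C_space :: "real \<Rightarrow> (real \<Rightarrow>\<^sub>C 'a::real_normed_vector) set" where
  "C_space \<tau> = {\<phi>. \<forall>\<theta>. apply_bcontfun \<phi> \<theta> = apply_bcontfun \<phi> (clamp (- \<tau>) 0 \<theta>)}"

definition segment :: "real \<Rightarrow> (real \<Rightarrow> 'a::real_normed_vector) \<Rightarrow> real \<Rightarrow> (real \<Rightarrow>\<^sub>C 'a)" where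
  "segment \<tau> u t = Bcontfun (\<lambda>\<theta>. u (t + clamp (- \<tau>) 0 \<theta>))"

lemma clamp_real_in: "0 < \<tau> \<Longrightarrow> clamp (- \<tau>) 0 (\<theta>::real) \<in> {- \<tau>..0}"
  using clamp_in_interval[of "- \<tau>" 0 \<theta>] by simp

lemma clamp_real_id: "\<theta> \<in> {- \<tau>..0} \<Longrightarrow> clamp (- \<tau>) 0 (\<theta>::real) = \<theta>"
  by (rule clamp_cancel_cbox) simp

lemma bcontfun_clamp:
  fixes f :: "real \<Rightarrow> 'a::real_normed_vector"
  assumes "0 < \<tau>" "continuous_on {- \<tau>..0} f"
  shows "(\<lambda>\<theta>. f (clamp (- \<tau>) 0 \<theta>)) \<in> bcontfun"
proof -
  have "continuous_on (cbox (- \<tau>) 0) f" using assms by simp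
  from clamp_continuous_on[OF this]
  have "continuous_on UNIV (\<lambda>\<theta>. f (clamp (- \<tau>) 0 \<theta>))" by simp
  moreover have "bounded (f ` {- \<tau>..0})"
    using assms(2) by (intro compact_imp_bounded compact_continuous_image) auto
  then have "bounded (range (\<lambda>\<theta>. f (clamp (- \<tau>) 0 \<theta>)))"
    by (rule bounded_subset) (use clamp_real_in[OF assms(1)] in blast)
  ultimately show ?thesis by (simp add: bcontfun_def)
qed

lemma norm_C_space:
  assumes "0 < \<tau>" "\<phi> \<in> C_space \<tau>"
  shows "norm \<phi> = (SUP \<theta>\<in>{- \<tau>..0}. norm (apply_bcontfun \<phi> \<theta>))"
proof -
  have "range (\<lambda>\<theta>. norm (apply_bcontfun \<phi> \<theta>)) = (\<lambda>\<theta>. norm (apply_bcontfun \<phi> \<theta>)) ` {- \<tau>..0}"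
  proof safe
    fix \<theta>
    have "apply_bcontfun \<phi> \<theta> = apply_bcontfun \<phi> (clamp (- \<tau>) 0 \<theta>)"
      using assms(2) unfolding C_space_def by blast
    then show "norm (apply_bcontfun \<phi> \<theta>) \<in> (\<lambda>\<theta>. norm (apply_bcontfun \<phi> \<theta>)) ` {- \<tau>..0}"
      using clamp_real_in[OF assms(1), of \<theta>] by (metis imageI)
  qed auto
  then show ?thesis by (simp add: norm_bcontfun_def dist_bcontfun_def)
qed

lemma bij_betw_restrict_C_space:
  assumes "0 < \<tau>"
  shows "bij_betw (\<lambda>\<phi>. restrict (apply_bcontfun \<phi>) {- \<tau>..0}) (C_space \<tau>)
    {f :: real \<Rightarrow> 'a::real_normed_vector. f \<in> extensional {- \<tau>..0} \<and> continuous_on {- \<tau>..0} f}"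
proof (rule bij_betw_imageI)
  show "inj_on (\<lambda>\<phi>. restrict (apply_bcontfun \<phi>) {- \<tau>..0})
      (C_space \<tau> :: (real \<Rightarrow>\<^sub>C 'a) set)"
  proof (rule inj_onI)
    fix \<phi> \<psi> :: "real \<Rightarrow>\<^sub>C 'a"
    assume C: "\<phi> \<in> C_space \<tau>" "\<psi> \<in> C_space \<tau>"
      and eq: "restrict (apply_bcontfun \<phi>) {- \<tau>..0} = restrict (apply_bcontfun \<psi>) {- \<tau>..0}"
    show "\<phi> = \<psi>"
    proof (rule bcontfun_eqI)
      fix \<theta>
      have "apply_bcontfun \<phi> (clamp (- \<tau>) 0 \<theta>) = apply_bcontfun \<psi> (clamp (- \<tau>) 0 \<theta>)"
        using fun_cong[OF eq, of "clamp (- \<tau>) 0 \<theta>"] clamp_real_in[OF assms, of \<theta>]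
        by (simp only: restrict_apply if_True)
      moreover have "apply_bcontfun \<phi> \<theta> = apply_bcontfun \<phi> (clamp (- \<tau>) 0 \<theta>)"
        "apply_bcontfun \<psi> \<theta> = apply_bcontfun \<psi> (clamp (- \<tau>) 0 \<theta>)"
        using C unfolding C_space_def by blast+
      ultimately show "apply_bcontfun \<phi> \<theta> = apply_bcontfun \<psi> \<theta>" by (simp only:)
    qed
  qed
  show "(\<lambda>\<phi>. restrict (apply_bcontfun \<phi>) {- \<tau>..0}) ` C_space \<tau> =
      {f :: real \<Rightarrow> 'a. f \<in> extensional {- \<tau>..0} \<and> continuous_on {- \<tau>..0} f}"
  proof (intro equalityI subsetI)
    fix f :: "real \<Rightarrow> 'a"
    assume "f \<in> (\<lambda>\<phi>. restrict (apply_bcontfun \<phi>) {- \<tau>..0}) ` C_space \<tau>"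
    then obtain \<phi> where f: "f = restrict (apply_bcontfun \<phi>) {- \<tau>..0}" by blast
    have "continuous_on {- \<tau>..0} (apply_bcontfun \<phi>)"
      using continuous_on_apply_bcontfun by blast
    then have "continuous_on {- \<tau>..0} f"
      by (rule continuous_on_eq) (simp add: f)
    then show "f \<in> {f. f \<in> extensional {- \<tau>..0} \<and> continuous_on {- \<tau>..0} f}"
      by (simp add: f)
  next
    fix f :: "real \<Rightarrow> 'a"
    assume f: "f \<in> {f. f \<in> extensional {- \<tau>..0} \<and> continuous_on {- \<tau>..0} f}"
    define \<phi> where "\<phi> = Bcontfun (\<lambda>\<theta>. f (clamp (- \<tau>) 0 \<theta>))"
    have ap: "apply_bcontfun \<phi> \<theta> = f (clamp (- \<tau>) 0 \<theta>)" for \<theta>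
      unfolding \<phi>_def using f assms by (subst Bcontfun_inverse) (auto intro: bcontfun_clamp)
    have "\<phi> \<in> C_space \<tau>"
      using clamp_real_id[OF clamp_real_in[OF assms]] by (simp add: C_space_def ap)
    moreover have "f = restrict (apply_bcontfun \<phi>) {- \<tau>..0}"
      using f by (auto simp: fun_eq_iff restrict_def ap clamp_real_id extensional_def
          simp del: atLeastAtMost_iff)
    ultimately show "f \<in> (\<lambda>\<phi>. restrict (apply_bcontfun \<phi>) {- \<tau>..0}) ` C_space \<tau>" by blast
  qed
qed

lemma segment_in_C_space:
  fixes u :: "real \<Rightarrow> 'a::real_normed_vector"
  assumes "0 < \<tau>" "continuous_on {- \<tau>..} u" "0 \<le> t"
  shows segment_mem: "segment \<tau> u t \<in> C_space \<tau>"
    and apply_segment: "\<theta> \<in> {- \<tau>..0} \<Longrightarrow> apply_bcontfun (segment \<tau> u t) \<theta> = u (t + \<theta>)"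
proof -
  have "continuous_on {- \<tau>..0} (\<lambda>\<theta>. u (t + \<theta>))"
    using assms by (intro continuous_on_compose2[OF assms(2)] continuous_intros) auto
  then have ap: "apply_bcontfun (segment \<tau> u t) \<theta> = u (t + clamp (- \<tau>) 0 \<theta>)" for \<theta>
    unfolding segment_def
    by (subst Bcontfun_inverse) (use bcontfun_clamp[OF assms(1)] in blast, simp)
  then show "segment \<tau> u t \<in> C_space \<tau>"
    using clamp_real_id[OF clamp_real_in[OF assms(1)]] by (simp add: C_space_def ap)
  show "\<theta> \<in> {- \<tau>..0} \<Longrightarrow> apply_bcontfun (segment \<tau> u t) \<theta> = u (t + \<theta>)"
    by (simp only: ap clamp_real_id)
qed


section \<open>Semigroups and mild solutions\<close>

definition C0_semigroup :: "(real \<Rightarrow> 'a::real_normed_vector \<Rightarrow>\<^sub>L 'a) \<Rightarrow> bool" where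
  "C0_semigroup T \<longleftrightarrow>
     T 0 = id_blinfun \<and>
     (\<forall>s\<ge>0. \<forall>t\<ge>0. T (s + t) = T s o\<^sub>L T t) \<and>
     (\<forall>x. ((\<lambda>t. blinfun_apply (T t) x) \<longlongrightarrow> x) (at_right 0))"

text \<open>The unbounded operator \<open>A\<close> is given by its domain \<open>D\<close> and its values on \<open>D\<close>.\<close>

definition infinitesimal_generator ::
    "(real \<Rightarrow> 'a::real_normed_vector \<Rightarrow>\<^sub>L 'a) \<Rightarrow> 'a set \<Rightarrow> ('a \<Rightarrow> 'a) \<Rightarrow> bool" where
  "infinitesimal_generator T D A \<longleftrightarrow>
     D = {x. \<exists>y. ((\<lambda>h. (blinfun_apply (T h) x - x) /\<^sub>R h) \<longlongrightarrow> y) (at_right 0)} \<and>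
     (\<forall>x\<in>D. ((\<lambda>h. (blinfun_apply (T h) x - x) /\<^sub>R h) \<longlongrightarrow> A x) (at_right 0))"

definition compact_operator :: "('a::real_normed_vector \<Rightarrow>\<^sub>L 'b::real_normed_vector) \<Rightarrow> bool" where
  "compact_operator K \<longleftrightarrow> (\<forall>B. bounded B \<longrightarrow> compact (closure (blinfun_apply K ` B)))"

definition mild_solution ::
    "real \<Rightarrow> (real \<Rightarrow> 'a::banach \<Rightarrow>\<^sub>L 'a) \<Rightarrow> (real \<Rightarrow> (real \<Rightarrow>\<^sub>C 'a) \<Rightarrow> 'a) \<Rightarrow>
     (real \<Rightarrow>\<^sub>C 'a) \<Rightarrow> (real \<Rightarrow> 'a) \<Rightarrow> bool" where
  "mild_solution \<tau> T F \<phi> u \<longleftrightarrow>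
     continuous_on {- \<tau>..} u \<and>
     (\<forall>\<theta>\<in>{- \<tau>..0}. u \<theta> = apply_bcontfun \<phi> \<theta>) \<and>
     (\<forall>t\<ge>0. u t = blinfun_apply (T t) (apply_bcontfun \<phi> 0) +
        integral {0..t} (\<lambda>s. blinfun_apply (T (t - s)) (F s (segment \<tau> u s))))"


section \<open>Equivalent norms and the measure of noncompactness\<close>

definition norm_on :: "'b::real_vector set \<Rightarrow> ('b \<Rightarrow> real) \<Rightarrow> bool" where
  "norm_on V N \<longleftrightarrow>
     (\<forall>x\<in>V. 0 \<le> N x) \<and>
     (\<forall>x\<in>V. N x = 0 \<longleftrightarrow> x = 0) \<and>
     (\<forall>x\<in>V. \<forall>a. N (a *\<^sub>R x) = \<bar>a\<bar> * N x) \<and>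
     (\<forall>x\<in>V. \<forall>y\<in>V. N (x + y) \<le> N x + N y)"

definition equivalent_norm_on :: "'b::real_normed_vector set \<Rightarrow> ('b \<Rightarrow> real) \<Rightarrow> bool" where
  "equivalent_norm_on V N \<longleftrightarrow>
     norm_on V N \<and> (\<exists>c1>0. \<exists>c2>0. \<forall>x\<in>V. c1 * norm x \<le> N x \<and> N x \<le> c2 * norm x)"

text \<open>The diameter takes values in \<open>[0, \<infinity>]\<close>, so that unbounded sets have infinite diameter.\<close>

definition diameter_wrt :: "('b::real_vector \<Rightarrow> real) \<Rightarrow> 'b set \<Rightarrow> ennreal" where
  "diameter_wrt N S = (SUP x\<in>S. SUP y\<in>S. ennreal (N (x - y)))"

definition kuratowski :: "'b::real_vector set \<Rightarrow> ('b \<Rightarrow> real) \<Rightarrow> 'b set \<Rightarrow> real" where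
  "kuratowski V N B = Inf {d. 0 < d \<and>
     (\<exists>\<S>. finite \<S> \<and> B \<subseteq> \<Union>\<S> \<and> (\<forall>S\<in>\<S>. S \<subseteq> V \<and> diameter_wrt N S \<le> ennreal d))}"

end

theory Submission
  imports Defs
begin

text \<open>
  For a bounded set \<open>B\<close> of initial data put \<open>g \<phi> s = u \<phi> s - exp (- r * s) *\<^sub>R T s (\<phi> 0)\<close>. The
  variation of constants formula gives \<open>g \<phi> 0 = 0\<close> and
  \<open>norm (g \<phi> (s + h) - T h (g \<phi> s)) \<le> c * h\<close> uniformly in \<open>\<phi> \<in> B\<close>, and since \<open>T \<epsilon>\<close> is compact
  for \<open>\<epsilon> > 0\<close> such a family is totally bounded in the supremum norm on \<open>[0, t]\<close>. So up to a
  relatively compact perturbation \<open>Q t\<close> is the linear flow of the rescaled semigroup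
  \<open>exp (- r * s) *\<^sub>R T s\<close>. This flow contracts by the factor \<open>exp (- r * t)\<close> in the norm
  \<open>SUP \<theta>\<in>{- \<tau>..0}. exp (r * \<theta>) * (SUP s\<in>{0..}. norm (T s (\<phi> \<theta>)))\<close>, in which \<open>T\<close> is a
  contraction on \<open>X\<close>.
\<close>

section \<open>Continuity of history segments in time\<close>

lemma apply_segment_clamp:
  fixes u :: "real \<Rightarrow> 'a::real_normed_vector"
  assumes "0 < \<tau>" "continuous_on {- \<tau>..} u" "0 \<le> t"
  shows "apply_bcontfun (segment \<tau> u t) \<theta> = u (t + clamp (- \<tau>) 0 \<theta>)"
proof -
  have "apply_bcontfun (segment \<tau> u t) \<theta> = apply_bcontfun (segment \<tau> u t) (clamp (- \<tau>) 0 \<theta>)"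
    using segment_mem[OF assms] unfolding C_space_def by blast
  then show ?thesis
    using apply_segment[OF assms clamp_real_in[OF assms(1)]] by simp
qed

text \<open>Uniform continuity of \<open>u\<close> on a compact interval makes a small time shift
  small at every \<theta> at once, hence small in the supremum norm. This gives continuity of the
  integrand in the mild formulation.\<close>

lemma continuous_on_segment:
  fixes u :: "real \<Rightarrow> 'a::real_normed_vector"
  assumes \<tau>: "0 < \<tau>" and u: "continuous_on {- \<tau>..} u"
  shows "continuous_on {0..} (segment \<tau> u)"
  unfolding continuous_on_iff
proof (intro ballI allI impI)
  fix t e :: real assume t: "t \<in> {0..}" and "e > 0"
  have "uniformly_continuous_on {- \<tau>..t + 1} u"
    by (intro compact_uniformly_continuous continuous_on_subset[OF u]) auto
  then obtain d where d: "d > 0"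
    "\<And>x y. x \<in> {- \<tau>..t + 1} \<Longrightarrow> y \<in> {- \<tau>..t + 1} \<Longrightarrow> dist y x < d \<Longrightarrow> dist (u y) (u x) < e / 2"
    using \<open>e > 0\<close> unfolding uniformly_continuous_on_def by (meson half_gt_zero)
  \<comment> \<open>The cap 1 in \<open>min d 1\<close> keeps all shifted arguments below
    \<open>t + 1\<close>, inside the interval of uniform continuity.\<close>
  show "\<exists>d>0. \<forall>s\<in>{0..}. dist s t < d \<longrightarrow> dist (segment \<tau> u s) (segment \<tau> u t) < e"
  proof (intro exI[of _ "min d 1"] conjI ballI impI)
    fix s :: real assume s: "s \<in> {0..}" "dist s t < min d 1"
    have "dist (segment \<tau> u s) (segment \<tau> u t) \<le> e / 2"
    proof (rule dist_bound)
      fix \<theta> :: real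
      have "dist (u (s + clamp (- \<tau>) 0 \<theta>)) (u (t + clamp (- \<tau>) 0 \<theta>)) < e / 2"
        using clamp_real_in[OF \<tau>, of \<theta>] s t by (intro d(2)) (auto simp: dist_real_def)
      then show "dist (segment \<tau> u s \<theta>) (segment \<tau> u t \<theta>) \<le> e / 2"
        using s t by (simp add: apply_segment_clamp[OF \<tau> u])
    qed
    then show "dist (segment \<tau> u s) (segment \<tau> u t) < e" using \<open>e > 0\<close> by simp
  qed (use d(1) in simp)
qed

section \<open>Equivalent norms and noncompactness of images\<close>

text \<open>Homogeneity follows from its one-sided form by applying that to the inverse scalar, and
  definiteness from the comparison with \<open>norm\<close>. Since \<open>c2\<close> may have any
  sign, \<open>max 1 c2\<close> serves as the positive upper constant.\<close>

lemma equivalent_norm_onI: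
  assumes scale: "\<And>a x. x \<in> V \<Longrightarrow> a *\<^sub>R x \<in> V"
    and c1: "0 < c1" "\<And>x. x \<in> V \<Longrightarrow> c1 * norm x \<le> N x"
    and c2: "\<And>x. x \<in> V \<Longrightarrow> N x \<le> c2 * norm x"
    and hom: "\<And>a x. x \<in> V \<Longrightarrow> N (a *\<^sub>R x) \<le> \<bar>a\<bar> * N x"
    and add: "\<And>x y. x \<in> V \<Longrightarrow> y \<in> V \<Longrightarrow> N (x + y) \<le> N x + N y"
  shows "equivalent_norm_on V N"
  unfolding equivalent_norm_on_def norm_on_def
proof (intro conjI ballI allI)
  fix x assume x: "x \<in> V"
  have "0 \<le> c1 * norm x" using c1(1) by simp
  then show nonneg: "0 \<le> N x" using c1(2)[OF x] by linarith
  show "N x = 0 \<longleftrightarrow> x = 0"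
  proof
    assume "N x = 0"
    then have "c1 * norm x \<le> 0" using c1(2)[OF x] by simp
    then show "x = 0" using c1(1) by (simp add: mult_le_0_iff)
  next
    assume "x = 0"
    then show "N x = 0" using c2[OF x] nonneg by simp
  qed
  show "N (a *\<^sub>R x) = \<bar>a\<bar> * N x" for a
  proof (cases "a = 0")
    case True
    then show ?thesis using hom[OF x, of a] c1(2)[OF scale[OF x, of a]] by simp
  next
    case False
    have "\<bar>a\<bar> * N x = \<bar>a\<bar> * N (inverse a *\<^sub>R a *\<^sub>R x)" using False by simp
    also have "\<dots> \<le> \<bar>a\<bar> * (\<bar>inverse a\<bar> * N (a *\<^sub>R x))"
      by (intro mult_left_mono hom scale x) simp
    also have "\<dots> = N (a *\<^sub>R x)" using False by simp
    finally show ?thesis using hom[OF x, of a] by simp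
  qed
  show "N (x + y) \<le> N x + N y" if "y \<in> V" for y using add[OF x that] .
next
  have "c2 * norm x \<le> max 1 c2 * norm x" for x :: 'a by (intro mult_right_mono) auto
  then show "\<exists>c1>0. \<exists>c2>0. \<forall>x\<in>V. c1 * norm x \<le> N x \<and> N x \<le> c2 * norm x"
    using c1 c2 by (intro exI[of _ c1] conjI exI[of _ "max 1 c2"] ballI) (auto intro: order_trans)
qed

text \<open>Cutting each set of a cover of \<open>B\<close> along the finitely many fibres of
  \<open>p \<eta>\<close> keeps the cover finite. If the sets have diameter at most
  \<open>d\<close>, the images of the pieces have diameter at most \<open>q * d + \<eta>\<close>.
  Then \<eta> tends to 0, and \<open>d\<close> runs over all admissible bounds.\<close>

lemma kuratowski_image_le:
  fixes p :: "real \<Rightarrow> 'b::real_vector \<Rightarrow> 'c"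
  assumes "B \<subseteq> V" "Q ` B \<subseteq> V" "0 < q"
    and "0 < D" "diameter_wrt N B \<le> ennreal D"
    and p: "\<And>\<eta>. 0 < \<eta> \<Longrightarrow> finite (p \<eta> ` B)"
      "\<And>\<eta> x y. 0 < \<eta> \<Longrightarrow> x \<in> B \<Longrightarrow> y \<in> B \<Longrightarrow> p \<eta> x = p \<eta> y \<Longrightarrow>
         N (Q x - Q y) \<le> q * N (x - y) + \<eta>"
  shows "kuratowski V N (Q ` B) \<le> q * kuratowski V N B"
proof -
  define covers where "covers B d \<longleftrightarrow>
    (\<exists>\<S>. finite \<S> \<and> B \<subseteq> \<Union>\<S> \<and> (\<forall>S\<in>\<S>. S \<subseteq> V \<and> diameter_wrt N S \<le> ennreal d))" for B d
  have kuratowski: "kuratowski V N B = Inf {d. 0 < d \<and> covers B d}" for B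
    by (simp add: kuratowski_def covers_def)
  have covers: "covers (Q ` B) (q * d + \<eta>)" if "0 < d" "covers B d" "0 < \<eta>" for d \<eta>
  proof -
    obtain \<S> where \<S>: "finite \<S>" "B \<subseteq> \<Union>\<S>" "\<And>S. S \<in> \<S> \<Longrightarrow> diameter_wrt N S \<le> ennreal d"
      using \<open>covers B d\<close> by (auto simp: covers_def)
    define piece where "piece = (\<lambda>(S, a). Q ` {x \<in> S \<inter> B. p \<eta> x = a})"
    have "diameter_wrt N (piece (S, a)) \<le> ennreal (q * d + \<eta>)" if S: "S \<in> \<S>" for S a
      unfolding diameter_wrt_def
    proof (intro SUP_least)
      fix x' y' assume "x' \<in> piece (S, a)" "y' \<in> piece (S, a)"
      then obtain x y where xy: "x' = Q x" "y' = Q y" "x \<in> S" "y \<in> S" "x \<in> B" "y \<in> B" "p \<eta> x = p \<eta> y"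
        by (auto simp: piece_def)
      have "ennreal (N (x - y)) \<le> diameter_wrt N S"
        unfolding diameter_wrt_def using xy by (meson SUP_upper order_trans)
      then have "ennreal (N (x - y)) \<le> ennreal d" using \<S>(3)[OF S] by simp
      then have "N (x - y) \<le> d" using \<open>0 < d\<close> by simp
      then have "q * N (x - y) \<le> q * d" using \<open>0 < q\<close> by simp
      then show "ennreal (N (x' - y')) \<le> ennreal (q * d + \<eta>)"
        using p(2)[OF \<open>0 < \<eta>\<close> xy(5-7)] xy(1,2) by (intro ennreal_leI) simp
    qed
    moreover have "Q ` B \<subseteq> \<Union> (piece ` (\<S> \<times> p \<eta> ` B))"
      using \<S>(2) by (fastforce simp: piece_def)
    moreover have "piece (S, a) \<subseteq> V" for S a using assms(2) by (auto simp: piece_def)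
    ultimately show ?thesis
      unfolding covers_def using \<S>(1) p(1)[OF \<open>0 < \<eta>\<close>]
      by (intro exI[of _ "piece ` (\<S> \<times> p \<eta> ` B)"]) auto
  qed
  \<comment> \<open>Division by \<open>q\<close> yields a lower bound for every admissible
    \<open>d\<close>, the form needed to pass to the infimum.\<close>
  have "kuratowski V N (Q ` B) / q \<le> d" if d: "0 < d" "covers B d" for d
  proof -
    have "kuratowski V N (Q ` B) \<le> q * d + \<eta>" if "0 < \<eta>" for \<eta>
      unfolding kuratowski using covers[OF d that] d(1) that assms(3)
      by (intro cInf_lower bdd_belowI[of _ 0]) (auto intro: add_pos_pos)
    then have "kuratowski V N (Q ` B) \<le> q * d" by (rule field_le_epsilon)
    then show ?thesis using assms(3) by (simp add: field_simps)
  qed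
  \<comment> \<open>The real infimum is a greatest lower bound only over a nonempty set; the cover
    of \<open>B\<close> by itself supplies a member.\<close>
  moreover have "covers B D"
    unfolding covers_def using assms by (intro exI[of _ "{B}"]) auto
  ultimately have "kuratowski V N (Q ` B) / q \<le> kuratowski V N B"
    unfolding kuratowski[of B] using assms(4) by (intro cInf_greatest) auto
  then show ?thesis using assms(3) by (simp add: field_simps)
qed

section \<open>Compact semigroups and mild solutions\<close>

locale bounded_C0_semigroup =
  fixes T :: "real \<Rightarrow> 'a::banach \<Rightarrow>\<^sub>L 'a" and M :: real
  assumes semigroup: "C0_semigroup T"
    and norm_le: "t \<ge> 0 \<Longrightarrow> norm (T t) \<le> M"
begin

lemma zero_apply [simp]: "T 0 x = x"
  using semigroup by (simp add: C0_semigroup_def)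

lemma add_apply: "s \<ge> 0 \<Longrightarrow> t \<ge> 0 \<Longrightarrow> T (s + t) x = T s (T t x)"
  using semigroup by (simp add: C0_semigroup_def)

lemma tendsto_at_right_0: "((\<lambda>t. T t x) \<longlongrightarrow> x) (at_right 0)"
  using semigroup by (simp add: C0_semigroup_def)

lemma bound_nonneg: "0 \<le> M"
  using norm_le[of 0] norm_ge_zero order_trans by blast

lemma norm_apply_le:
  assumes "t \<ge> 0"
  shows "norm (T t x) \<le> M * norm x"
  using norm_blinfun[of "T t" x] mult_right_mono[OF norm_le[OF assms], of "norm x"] by simp

text \<open>Strong continuity is uniform on a finite net of \<open>K\<close>, and the common bound
  \<open>M\<close> on the operators carries it over to the points near the net.\<close>

lemma uniformly_tendsto_on_compact:
  assumes "compact K" "e > 0"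
  obtains \<delta> where "\<delta> > 0" "\<And>h x. 0 \<le> h \<Longrightarrow> h \<le> \<delta> \<Longrightarrow> x \<in> K \<Longrightarrow> norm (T h x - x) \<le> e"
proof -
  define \<rho> where "\<rho> = e / (2 * (M + 1))"
  have \<rho>: "\<rho> > 0" "(M + 1) * \<rho> = e / 2"
    using assms(2) bound_nonneg by (auto simp: \<rho>_def field_simps)
  obtain P where P: "finite P" "K \<subseteq> (\<Union>p\<in>P. ball p \<rho>)"
    using assms(1) \<rho>(1) unfolding compact_eq_totally_bounded by meson
  have "\<forall>\<^sub>F h in at_right 0. norm (T h p - p) < e / 2" for p
    using tendstoD[OF tendsto_at_right_0[of p], of "e / 2"] assms(2) by (simp add: dist_norm)
  then have "\<forall>\<^sub>F h in at_right 0. \<forall>p\<in>P. norm (T h p - p) < e / 2"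
    using P(1) by (intro eventually_ball_finite) auto
  then obtain \<delta>' where \<delta>': "\<delta>' > 0" "\<And>h p. 0 < h \<Longrightarrow> h < \<delta>' \<Longrightarrow> p \<in> P \<Longrightarrow> norm (T h p - p) < e / 2"
    by (auto simp: eventually_at_right_field)
  show thesis
  proof (rule that[of "\<delta>' / 2"])
    fix h x assume h: "0 \<le> h" "h \<le> \<delta>' / 2" and x: "x \<in> K"
    obtain p where p: "p \<in> P" "norm (x - p) < \<rho>"
      using P(2) x by (auto simp: dist_norm norm_minus_commute)
    \<comment> \<open>The filter \<open>at_right 0\<close> says nothing about \<open>h = 0\<close>,
      where the difference vanishes.\<close>
    have hp: "norm (T h p - p) \<le> e / 2"
      using \<delta>'(2)[of h p] h \<delta>'(1) p(1) assms(2) by (cases "h = 0") auto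
    have "T h x - x = (T h (x - p) - (x - p)) + (T h p - p)"
      by (simp add: blinfun.diff_right)
    also have "norm \<dots> \<le> norm (T h (x - p)) + norm (x - p) + norm (T h p - p)"
      by (meson norm_triangle_ineq norm_triangle_ineq4 add_mono order_refl order_trans)
    also have "\<dots> \<le> (M + 1) * norm (x - p) + e / 2"
      using norm_apply_le[OF h(1), of "x - p"] hp by (simp add: algebra_simps)
    also have "\<dots> \<le> (M + 1) * \<rho> + e / 2"
      using p(2) bound_nonneg by (intro add_right_mono mult_left_mono) auto
    finally show "norm (T h x - x) \<le> e" using \<rho>(2) by simp
  qed (use \<delta>'(1) in simp)
qed

text \<open>For \<open>s \<le> t\<close> the increment is \<open>T s (T (t - s) x - x)\<close>, so
  the bound \<open>M\<close> reduces uniform continuity of the orbit to right continuity at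
  0.\<close>

lemma continuous_on_orbit: "continuous_on {0..} (\<lambda>t. T t x)"
proof (rule uniformly_continuous_imp_continuous, unfold uniformly_continuous_on_def, safe)
  fix e :: real assume "e > 0"
  define e' where "e' = e / (2 * (M + 1))"
  have e': "e' > 0" "M * e' < e" 
    using \<open>e > 0\<close> bound_nonneg by (auto simp: e'_def field_simps intro: add_nonneg_pos)
  have "compact {x}" by simp
  then obtain \<delta> where \<delta>: "\<delta> > 0"
    "\<And>h y. 0 \<le> h \<Longrightarrow> h \<le> \<delta> \<Longrightarrow> y \<in> {x} \<Longrightarrow> norm (T h y - y) \<le> e'"
    using uniformly_tendsto_on_compact[OF _ e'(1)] by blast
  have *: "norm (T t x - T s x) < e" if "0 \<le> s" "s \<le> t" "t - s < \<delta>" for s t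
  proof -
    have "T t x - T s x = T s (T (t - s) x - x)"
      using add_apply[of s "t - s" x] that by (simp add: blinfun.diff_right)
    then have "norm (T t x - T s x) \<le> M * norm (T (t - s) x - x)"
      using norm_apply_le that(1) by simp
    also have "\<dots> \<le> M * e'"
      using that \<delta>(2)[of "t - s" x] bound_nonneg by (intro mult_left_mono) auto
    finally show ?thesis using e'(2) by simp
  qed
  show "\<exists>d>0. \<forall>t\<in>{0..}. \<forall>s\<in>{0..}. dist s t < d \<longrightarrow> dist (T s x) (T t x) < e"
  proof (intro exI[of _ \<delta>] conjI ballI impI)
    fix s t :: real assume st: "t \<in> {0..}" "s \<in> {0..}" "dist s t < \<delta>"
    show "dist (T s x) (T t x) < e"
      using *[of s t] *[of t s] st
      by (cases "s \<le> t") (auto simp: dist_norm norm_minus_commute)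
  qed (rule \<delta>)
qed

text \<open>Joint continuity: the change of the vector costs at most
  \<open>M * norm (f s' - f s)\<close>, and for the fixed vector \<open>f s\<close> the orbit is
  continuous.\<close>

lemma continuous_on_apply:
  fixes f :: "'b::topological_space \<Rightarrow> 'a"
  assumes "continuous_on S f" "continuous_on S g" "g ` S \<subseteq> {0..}"
  shows "continuous_on S (\<lambda>s. T (g s) (f s))"
  unfolding continuous_on_def
proof
  fix s assume s: "s \<in> S"
  have "continuous_on S (\<lambda>s'. T (g s') (f s))"
    using continuous_on_compose2[OF continuous_on_orbit assms(2,3)] .
  then have 1: "((\<lambda>s'. T (g s') (f s)) \<longlongrightarrow> T (g s) (f s)) (at s within S)"
    using s by (simp add: continuous_on_def)
  have "(f \<longlongrightarrow> f s) (at s within S)"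
    using assms(1) s by (simp add: continuous_on_def)
  then have "((\<lambda>s'. M * norm (f s' - f s)) \<longlongrightarrow> 0) (at s within S)"
    by (intro tendsto_mult_right_zero tendsto_norm_zero LIM_zero)
  moreover have "\<forall>\<^sub>F s' in at s within S. norm (T (g s') (f s' - f s)) \<le> M * norm (f s' - f s)"
    unfolding eventually_at_filter using assms(3) by (intro always_eventually) (auto intro: norm_apply_le)
  ultimately have "((\<lambda>s'. T (g s') (f s' - f s)) \<longlongrightarrow> 0) (at s within S)"
    by (rule Lim_null_comparison[rotated])
  from tendsto_add[OF this 1] show "((\<lambda>s'. T (g s') (f s')) \<longlongrightarrow> T (g s) (f s)) (at s within S)"
    by (simp add: blinfun.diff_right)
qed

text \<open>Moving \<open>T h\<close> under the integral and using the semigroup law turns the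
  second term into the part of the first over \<open>{0..s}\<close>. What remains is an integral
  over an interval of length \<open>h\<close> with integrand bounded by
  \<open>M * c\<close>.\<close>

lemma norm_convolution_increment_le:
  assumes f: "continuous_on {0..s + h} f" and sh: "0 \<le> s" "0 \<le> h"
    and bound: "\<And>\<sigma>. \<sigma> \<in> {0..s + h} \<Longrightarrow> norm (f \<sigma>) \<le> c"
  shows "norm (integral {0..s + h} (\<lambda>\<sigma>. T (s + h - \<sigma>) (f \<sigma>))
    - T h (integral {0..s} (\<lambda>\<sigma>. T (s - \<sigma>) (f \<sigma>)))) \<le> M * c * h"
proof -
  have cont: "continuous_on {0..s + h} (\<lambda>\<sigma>. T (s + h - \<sigma>) (f \<sigma>))"
    by (intro continuous_on_apply f continuous_intros) auto
  have cont': "continuous_on {0..s} (\<lambda>\<sigma>. T (s - \<sigma>) (f \<sigma>))"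
    using sh by (intro continuous_on_apply continuous_on_subset[OF f] continuous_intros) auto
  have "T h (integral {0..s} (\<lambda>\<sigma>. T (s - \<sigma>) (f \<sigma>)))
      = integral {0..s} (\<lambda>\<sigma>. T h (T (s - \<sigma>) (f \<sigma>)))"
    using integral_linear[OF integrable_continuous_real[OF cont'] blinfun.bounded_linear_right[of "T h"]]
    by (simp add: o_def)
  also have "\<dots> = integral {0..s} (\<lambda>\<sigma>. T (s + h - \<sigma>) (f \<sigma>))"
  proof (rule integral_cong)
    fix \<sigma> assume "\<sigma> \<in> {0..s}"
    then show "T h (T (s - \<sigma>) (f \<sigma>)) = T (s + h - \<sigma>) (f \<sigma>)"
      using add_apply[of h "s - \<sigma>" "f \<sigma>"] sh by (simp add: algebra_simps)
  qed
  also have "integral {0..s + h} (\<lambda>\<sigma>. T (s + h - \<sigma>) (f \<sigma>)) - \<dots>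
      = integral {s..s + h} (\<lambda>\<sigma>. T (s + h - \<sigma>) (f \<sigma>))"
    using Henstock_Kurzweil_Integration.integral_combine[OF _ _ integrable_continuous_real[OF cont], of s] sh
    by (simp add: algebra_simps)
  also have "norm \<dots> \<le> M * c * (s + h - s)"
  proof (rule integral_bound)
    show "continuous_on {s..s + h} (\<lambda>\<sigma>. T (s + h - \<sigma>) (f \<sigma>))"
      using sh by (intro continuous_on_subset[OF cont]) auto
    fix \<sigma> assume \<sigma>: "\<sigma> \<in> {s..s + h}"
    have "norm (T (s + h - \<sigma>) (f \<sigma>)) \<le> M * norm (f \<sigma>)"
      using \<sigma> by (intro norm_apply_le) auto
    also have "\<dots> \<le> M * c"
      using \<sigma> sh bound_nonneg by (intro mult_left_mono bound) auto
    finally show "norm (T (s + h - \<sigma>) (f \<sigma>)) \<le> M * c" .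
  qed (use sh in simp)
  finally show ?thesis by simp
qed

end

section \<open>Total boundedness of approximate orbits\<close>

locale compact_C0_semigroup = bounded_C0_semigroup +
  assumes compact: "t > 0 \<Longrightarrow> compact_operator (T t)"
begin

text \<open>A quantitative Arzela-Ascoli argument. Compactness of \<open>T \<epsilon>\<close> puts
  all values near one compact set \<open>K\<close>, and uniform strong continuity on
  \<open>K\<close> gives equicontinuity. The label \<open>p i\<close> records approximate values of
  \<open>g i\<close> on a finite time grid, chosen from a finite net of \<open>K\<close>.\<close>

lemma finite_partition_of_approximate_orbits:
  fixes g :: "'i \<Rightarrow> real \<Rightarrow> 'a"
  assumes g0: "\<And>i. i \<in> I \<Longrightarrow> g i 0 = 0"
    and g: "\<And>i s h. i \<in> I \<Longrightarrow> 0 \<le> s \<Longrightarrow> 0 \<le> h \<Longrightarrow> s + h \<le> b \<Longrightarrow>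
              norm (g i (s + h) - T h (g i s)) \<le> c * h"
    and "0 \<le> c" "0 \<le> b" "0 < \<eta>"
  obtains p :: "'i \<Rightarrow> nat \<Rightarrow> 'a" where "finite (p ` I)"
    "\<And>i j s. i \<in> I \<Longrightarrow> j \<in> I \<Longrightarrow> p i = p j \<Longrightarrow> s \<in> {0..b} \<Longrightarrow> norm (g i s - g j s) \<le> \<eta>"
proof -
  \<comment> \<open>Each of two functions with equal labels will differ from the common label by at
    most \<open>3 * e + (M + 2) * (c * \<epsilon>)\<close>, which is at most \<open>4 * e\<close>.
    The summand in \<open>c + 1\<close> avoids division by 0.\<close>
  define e where "e = \<eta> / 8"
  define \<epsilon> where "\<epsilon> = e / ((M + 2) * (c + 1))"
  have "e > 0" using assms by (simp add: e_def)
  have \<epsilon>: "\<epsilon> > 0" "(M + 2) * (c * \<epsilon>) \<le> e"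
  proof -
    show "\<epsilon> > 0" using \<open>e > 0\<close> bound_nonneg assms(3) by (simp add: \<epsilon>_def)
    have "(M + 2) * (c * \<epsilon>) \<le> (M + 2) * ((c + 1) * \<epsilon>)"
      using \<open>\<epsilon> > 0\<close> bound_nonneg by (intro mult_left_mono mult_right_mono) auto
    also have "\<dots> = e" using bound_nonneg assms(3) by (simp add: \<epsilon>_def)
    finally show "(M + 2) * (c * \<epsilon>) \<le> e" .
  qed
  have g_le: "norm (g i s) \<le> c * s" if "i \<in> I" "s \<in> {0..b}" for i s
    using g[OF that(1), of 0 s] g0[OF that(1)] that(2) by simp
  \<comment> \<open>By \<open>g_le\<close> all values \<open>g i s\<close> lie in this ball, so
    \<open>K\<close> contains their images under \<open>T \<epsilon>\<close>.\<close>
  define K where "K = closure (T \<epsilon> ` cball 0 (c * b))"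
  have K: "compact K"
    using compact[OF \<epsilon>(1)] unfolding compact_operator_def K_def by simp
  \<comment> \<open>For \<open>s \<ge> \<epsilon>\<close> the value \<open>g i s\<close> is close to \<open>T \<epsilon> (g i (s - \<epsilon>))\<close>, for \<open>s < \<epsilon>\<close> it is close to \<open>0\<close>.\<close>
  have near_K: "\<exists>k\<in>K. norm (g i s - k) \<le> c * \<epsilon>" if i: "i \<in> I" and s: "s \<in> {0..b}" for i s
  proof (cases "s \<ge> \<epsilon>")
    case True
    have "norm (g i (s - \<epsilon>)) \<le> c * (s - \<epsilon>)"
      using True s \<epsilon>(1) by (intro g_le[OF i]) auto
    also have "\<dots> \<le> c * b" using s \<epsilon>(1) assms(3) by (intro mult_left_mono) auto
    finally have "T \<epsilon> (g i (s - \<epsilon>)) \<in> K"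
      unfolding K_def by (intro subsetD[OF closure_subset] imageI) simp
    then show ?thesis
      using g[OF i, of "s - \<epsilon>" \<epsilon>] True s \<epsilon>(1) by (intro bexI[of _ "T \<epsilon> (g i (s - \<epsilon>))"]) auto
  next
    case False
    have "T \<epsilon> 0 \<in> K"
      unfolding K_def using assms by (intro subsetD[OF closure_subset] imageI) simp
    moreover have "norm (g i s) \<le> c * \<epsilon>"
      using order_trans[OF g_le[OF i s] mult_left_mono[of s \<epsilon> c]] False assms(3) by simp
    ultimately show ?thesis by (intro bexI[of _ 0]) auto
  qed
  obtain \<delta>' where \<delta>': "\<delta>' > 0" "\<And>h x. 0 \<le> h \<Longrightarrow> h \<le> \<delta>' \<Longrightarrow> x \<in> K \<Longrightarrow> norm (T h x - x) \<le> e"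
    using uniformly_tendsto_on_compact[OF K \<open>e > 0\<close>] by blast
  \<comment> \<open>The bound \<delta>' makes \<open>T h\<close> almost the identity on
    \<open>K\<close>; the other makes the defect \<open>c * h\<close> at most
    \<open>e\<close>.\<close>
  define \<delta> where "\<delta> = min \<delta>' (e / (c + 1))"
  have \<delta>: "\<delta> > 0" "\<delta> \<le> \<delta>'" "c * \<delta> \<le> e"
  proof -
    show "\<delta> > 0" using \<delta>'(1) \<open>e > 0\<close> assms(3) by (simp add: \<delta>_def)
    show "\<delta> \<le> \<delta>'" by (simp add: \<delta>_def)
    have "c * \<delta> \<le> (c + 1) * (e / (c + 1))"
      using assms(3) \<open>\<delta> > 0\<close> by (intro mult_mono) (auto simp: \<delta>_def)
    then show "c * \<delta> \<le> e" using assms(3) by simp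
  qed
  \<comment> \<open>Compare \<open>g i (s + h)\<close> with \<open>T h (g i s)\<close>, then replace
    \<open>g i s\<close> by a nearby \<open>k\<close> in \<open>K\<close>: the replacement costs
    \<open>(M + 1) * (c * \<epsilon>)\<close>, and moving \<open>k\<close> by \<open>T h\<close>
    costs \<open>e\<close>.\<close>
  have equicont: "norm (g i (s + h) - g i s) \<le> 2 * e + (M + 1) * (c * \<epsilon>)"
    if i: "i \<in> I" and s: "0 \<le> s" "0 \<le> h" "s + h \<le> b" "h \<le> \<delta>" for i s h
  proof -
    obtain k where k: "k \<in> K" "norm (g i s - k) \<le> c * \<epsilon>"
      using near_K[OF i, of s] s by auto
    have "g i (s + h) - g i s
        = (g i (s + h) - T h (g i s)) + (T h (g i s - k) - (g i s - k)) + (T h k - k)"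
      by (simp add: blinfun.diff_right)
    also have "norm \<dots> \<le> norm (g i (s + h) - T h (g i s))
        + (norm (T h (g i s - k)) + norm (g i s - k)) + norm (T h k - k)"
      by (meson norm_triangle_ineq norm_triangle_ineq4 add_mono order_refl order_trans)
    also have "\<dots> \<le> e + (M + 1) * (c * \<epsilon>) + e"
    proof (intro add_mono)
      have "norm (g i (s + h) - T h (g i s)) \<le> c * h" using g[OF i] s by simp
      also have "\<dots> \<le> c * \<delta>" using s assms(3) by (intro mult_left_mono)
      finally show "norm (g i (s + h) - T h (g i s)) \<le> e" using \<delta>(3) by simp
      have "norm (T h (g i s - k)) + norm (g i s - k) \<le> (M + 1) * norm (g i s - k)"
        using norm_apply_le[OF s(2), of "g i s - k"] by (simp add: algebra_simps)
      also have "\<dots> \<le> (M + 1) * (c * \<epsilon>)"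
        using bound_nonneg by (intro mult_left_mono k) auto
      finally show "norm (T h (g i s - k)) + norm (g i s - k) \<le> (M + 1) * (c * \<epsilon>)" .
      show "norm (T h k - k) \<le> e" using \<delta>'(2)[OF s(2) _ k(1)] s \<delta>(2) by simp
    qed
    finally show ?thesis by simp
  qed
  obtain P where P: "finite P" "K \<subseteq> (\<Union>x\<in>P. ball x e)"
    using K \<open>e > 0\<close> unfolding compact_eq_totally_bounded by meson
  have near_P: "\<exists>x. x \<in> P \<and> norm (g i s - x) \<le> c * \<epsilon> + e" if i_s: "i \<in> I" "s \<in> {0..b}" for i s
  proof -
    obtain k where k: "k \<in> K" "norm (g i s - k) \<le> c * \<epsilon>" using near_K[OF i_s] by blast
    obtain x where "x \<in> P" "norm (k - x) < e"
      using P(2) k(1) by (auto simp: dist_norm norm_minus_commute)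
    then show ?thesis
      using k(2) norm_triangle_ineq[of "g i s - k" "k - x"] by (intro exI[of _ x]) auto
  qed
  \<comment> \<open>The grid points \<open>m * \<delta>\<close> with \<open>m \<le> n\<close> stay
    in \<open>{0..b}\<close>, and each time in that interval lies at most \<delta> to the right of
    one of them.\<close>
  define n where "n = nat \<lfloor>b / \<delta>\<rfloor>"
  \<comment> \<open>Restriction to \<open>{..n}\<close> fixes the values elsewhere, so all labels
    lie in a finite function space.\<close>
  define p where "p i = restrict (\<lambda>m. SOME x. x \<in> P \<and> norm (g i (m * \<delta>) - x) \<le> c * \<epsilon> + e) {..n}" for i
  have grid: "real m * \<delta> \<in> {0..b}" if "m \<le> n" for m
  proof -
    have "real m \<le> b / \<delta>" using that \<delta>(1) assms by (simp add: n_def le_nat_iff le_floor_iff)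
    then show ?thesis using \<delta>(1) by (simp add: field_simps)
  qed
  have p: "p i m \<in> P" "norm (g i (m * \<delta>) - p i m) \<le> c * \<epsilon> + e" if "i \<in> I" "m \<le> n" for i m
    using someI_ex[OF near_P[OF that(1) grid[OF that(2)]]] that(2) by (simp_all add: p_def)
  show thesis
  proof (rule that[of p])
    have "p i \<in> {..n} \<rightarrow>\<^sub>E P" if "i \<in> I" for i
    proof (rule PiE_I)
      show "p i m = undefined" if "m \<notin> {..n}" for m using that by (simp add: p_def)
    qed (use p(1) that in simp)
    then have "p ` I \<subseteq> {..n} \<rightarrow>\<^sub>E P" by blast
    then show "finite (p ` I)" using P(1) by (meson finite_PiE finite_atMost finite_subset)
  next
    fix i j s assume ij: "i \<in> I" "j \<in> I" "p i = p j" and s: "s \<in> {0..b}"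
    define m where "m = nat \<lfloor>s / \<delta>\<rfloor>"
    have m: "m \<le> n" using s \<delta>(1) by (auto simp: m_def n_def intro!: nat_mono floor_mono divide_right_mono)
    have "real m = of_int \<lfloor>s / \<delta>\<rfloor>" using s \<delta>(1) by (simp add: m_def)
    then have "real m \<le> s / \<delta>" "s / \<delta> < real m + 1" by linarith+
    then have ms: "real m * \<delta> \<le> s" "s - real m * \<delta> \<le> \<delta>"
      using \<delta>(1) by (simp_all add: field_simps)
    have close: "norm (g l s - p l m) \<le> 4 * e" if l: "l \<in> I" for l
    proof -
      have "norm (g l s - g l (m * \<delta>)) \<le> 2 * e + (M + 1) * (c * \<epsilon>)"
        using equicont[OF l, of "m * \<delta>" "s - m * \<delta>"] ms s \<delta>(1) by simp
      moreover have "norm (g l s - p l m) \<le> norm (g l s - g l (m * \<delta>)) + norm (g l (m * \<delta>) - p l m)"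
        using norm_triangle_ineq[of "g l s - g l (m * \<delta>)" "g l (m * \<delta>) - p l m"] by simp
      moreover have "norm (g l (m * \<delta>) - p l m) \<le> c * \<epsilon> + e" by (rule p(2)[OF l m])
      ultimately show ?thesis using \<epsilon>(2) by (simp add: algebra_simps)
    qed
    have "norm (g i s - g j s) \<le> norm (g i s - p i m) + norm (g j s - p j m)"
      using norm_triangle_ineq4[of "g i s - p i m" "g j s - p j m"] ij(3) by simp
    then show "norm (g i s - g j s) \<le> \<eta>"
      using close[OF ij(1)] close[OF ij(2)] by (simp add: e_def)
  qed
qed

end

text \<open>By the semigroup law the terms with the initial value cancel, leaving the increment of
  the convolution integral. Thus a solution is an orbit of \<open>T\<close> up to an error linear in
  \<open>h\<close>.\<close>

lemma (in bounded_C0_semigroup) mild_solution_increment: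
  assumes \<tau>: "0 < \<tau>" and u: "mild_solution \<tau> T F \<phi> u"
    and F: "continuous_on ({0..} \<times> C_space \<tau>) (\<lambda>(t, \<phi>). F t \<phi>)"
    and sh: "0 \<le> s" "0 \<le> h"
    and bound: "\<And>\<sigma>. \<sigma> \<in> {0..s + h} \<Longrightarrow> norm (F \<sigma> (segment \<tau> u \<sigma>)) \<le> c"
  shows "norm (u (s + h) - T h (u s)) \<le> M * c * h"
proof -
  have cont: "continuous_on {- \<tau>..} u" using u by (simp add: mild_solution_def)
  have "continuous_on {0..s + h} (\<lambda>\<sigma>. (\<sigma>, segment \<tau> u \<sigma>))"
    by (intro continuous_intros continuous_on_subset[OF continuous_on_segment[OF \<tau> cont]]) auto
  from continuous_on_compose2[OF F this]
  have f: "continuous_on {0..s + h} (\<lambda>\<sigma>. F \<sigma> (segment \<tau> u \<sigma>))"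
    using segment_mem[OF \<tau> cont] by force
  have eq: "u t = T t (\<phi> 0) + integral {0..t} (\<lambda>\<sigma>. T (t - \<sigma>) (F \<sigma> (segment \<tau> u \<sigma>)))" if "t \<ge> 0" for t
    using u that by (simp add: mild_solution_def)
  have "u (s + h) - T h (u s) = integral {0..s + h} (\<lambda>\<sigma>. T (s + h - \<sigma>) (F \<sigma> (segment \<tau> u \<sigma>)))
      - T h (integral {0..s} (\<lambda>\<sigma>. T (s - \<sigma>) (F \<sigma> (segment \<tau> u \<sigma>))))"
    using eq[of s] eq[of "s + h"] sh add_apply[of h s "\<phi> 0"]
    by (simp add: blinfun.add_right add.commute)
  then show ?thesis
    using norm_convolution_increment_le[OF f sh bound] by simp
qed

section \<open>The equivalent norm\<close>

context bounded_C0_semigroup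
begin

text \<open>The standard renorming that turns a bounded semigroup into a contraction
  semigroup.\<close>

definition orbit_norm :: "'a \<Rightarrow> real" where
  "orbit_norm x = (SUP t\<in>{0..}. norm (T t x))"

lemma norm_apply_le_orbit_norm:
  assumes "0 \<le> t"
  shows "norm (T t x) \<le> orbit_norm x"
  unfolding orbit_norm_def
proof (rule cSUP_upper)
  show "bdd_above ((\<lambda>t. norm (T t x)) ` {0..})"
    using norm_apply_le by (intro bdd_aboveI2[of _ _ "M * norm x"]) auto
qed (use assms in simp)

lemma orbit_norm_leI: "(\<And>t. 0 \<le> t \<Longrightarrow> norm (T t x) \<le> c) \<Longrightarrow> orbit_norm x \<le> c"
  unfolding orbit_norm_def by (rule cSUP_least) auto

lemma norm_le_orbit_norm: "norm x \<le> orbit_norm x"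
  using norm_apply_le_orbit_norm[of 0 x] by simp

lemma orbit_norm_nonneg: "0 \<le> orbit_norm x"
  using norm_le_orbit_norm[of x] norm_ge_zero[of x] by linarith

lemma orbit_norm_le: "orbit_norm x \<le> M * norm x"
  by (rule orbit_norm_leI) (rule norm_apply_le)

text \<open>The orbit of \<open>T t x\<close> is a tail of the orbit of \<open>x\<close>, so its
  supremum is no larger.\<close>

lemma orbit_norm_apply_le:
  assumes "0 \<le> t"
  shows "orbit_norm (T t x) \<le> orbit_norm x"
proof (rule orbit_norm_leI)
  fix s :: real assume "0 \<le> s"
  then show "norm (T s (T t x)) \<le> orbit_norm x"
    using norm_apply_le_orbit_norm[of "s + t" x] add_apply[of s t x] assms by simp
qed

lemma orbit_norm_add_le: "orbit_norm (x + y) \<le> orbit_norm x + orbit_norm y"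
proof (rule orbit_norm_leI)
  fix t :: real assume "0 \<le> t"
  then show "norm (T t (x + y)) \<le> orbit_norm x + orbit_norm y"
    unfolding blinfun.add_right by (intro norm_triangle_le add_mono norm_apply_le_orbit_norm)
qed

lemma orbit_norm_scaleR_le: "orbit_norm (a *\<^sub>R x) \<le> \<bar>a\<bar> * orbit_norm x"
  by (rule orbit_norm_leI)
    (simp add: blinfun.scaleR_right mult_left_mono norm_apply_le_orbit_norm)

text \<open>The weight gives decay to the part of the history that is merely shifted: moving a value
  from \<open>t + \<theta>\<close> to \<theta> multiplies its weight by
  \<open>exp (- r * t)\<close>.\<close>

definition weighted_norm :: "real \<Rightarrow> real \<Rightarrow> (real \<Rightarrow>\<^sub>C 'a) \<Rightarrow> real" where
  "weighted_norm \<tau> r \<phi> = (SUP \<theta>\<in>{- \<tau>..0}. exp (r * \<theta>) * orbit_norm (\<phi> \<theta>))"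

context
  fixes \<tau> r :: real
  assumes \<tau>: "0 < \<tau>" and r: "0 < r"
begin

lemma weighted_orbit_norm_le:
  fixes \<phi> :: "real \<Rightarrow>\<^sub>C 'a"
  assumes "\<theta> \<le> 0"
  shows "exp (r * \<theta>) * orbit_norm (\<phi> \<theta>) \<le> M * norm \<phi>"
proof -
  have "exp (r * \<theta>) * orbit_norm (\<phi> \<theta>) \<le> 1 * orbit_norm (\<phi> \<theta>)"
    using assms r by (intro mult_right_mono orbit_norm_nonneg) (auto simp: mult_nonneg_nonpos)
  also have "\<dots> \<le> M * norm (\<phi> \<theta>)" using orbit_norm_le by simp
  also have "\<dots> \<le> M * norm \<phi>" by (intro mult_left_mono norm_bounded bound_nonneg)
  finally show ?thesis .
qed

lemma weighted_norm_upper: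
  fixes \<phi> :: "real \<Rightarrow>\<^sub>C 'a"
  assumes "\<theta> \<in> {- \<tau>..0}"
  shows "exp (r * \<theta>) * orbit_norm (\<phi> \<theta>) \<le> weighted_norm \<tau> r \<phi>"
  unfolding weighted_norm_def
proof (rule cSUP_upper[OF assms])
  show "bdd_above ((\<lambda>\<theta>. exp (r * \<theta>) * orbit_norm (\<phi> \<theta>)) ` {- \<tau>..0})"
    using weighted_orbit_norm_le by (intro bdd_aboveI2[of _ _ "M * norm \<phi>"]) auto
qed

lemma weighted_norm_leI:
  fixes \<phi> :: "real \<Rightarrow>\<^sub>C 'a"
  assumes "\<And>\<theta>. \<theta> \<in> {- \<tau>..0} \<Longrightarrow> exp (r * \<theta>) * orbit_norm (\<phi> \<theta>) \<le> c"
  shows "weighted_norm \<tau> r \<phi> \<le> c"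
  unfolding weighted_norm_def using \<tau> assms by (intro cSUP_least) auto

lemma weighted_norm_le: "weighted_norm \<tau> r \<phi> \<le> M * norm \<phi>"
  by (rule weighted_norm_leI) (use weighted_orbit_norm_le in auto)

text \<open>On \<open>{- \<tau>..0}\<close> the weight lies between
  \<open>exp (- r * \<tau>)\<close> and 1, and \<open>orbit_norm\<close> lies between
  \<open>norm\<close> and \<open>M\<close> times \<open>norm\<close>.\<close>

lemma equivalent_weighted_norm: "equivalent_norm_on (C_space \<tau>) (weighted_norm \<tau> r)"
proof (rule equivalent_norm_onI)
  show "a *\<^sub>R \<phi> \<in> C_space \<tau>" if "\<phi> \<in> C_space \<tau>" for a and \<phi> :: "real \<Rightarrow>\<^sub>C 'a"
    using that by (simp add: C_space_def)
  show "0 < exp (- r * \<tau>)" by simp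
  show "exp (- r * \<tau>) * norm \<phi> \<le> weighted_norm \<tau> r \<phi>" if "\<phi> \<in> C_space \<tau>" for \<phi> :: "real \<Rightarrow>\<^sub>C 'a"
  proof -
    have "norm \<phi> \<le> exp (r * \<tau>) * weighted_norm \<tau> r \<phi>"
      unfolding norm_C_space[OF \<tau> that]
    proof (rule cSUP_least)
      fix \<theta> assume \<theta>: "\<theta> \<in> {- \<tau>..0}"
      have "norm (\<phi> \<theta>) \<le> exp (- (r * \<theta>)) * (exp (r * \<theta>) * orbit_norm (\<phi> \<theta>))"
        using norm_le_orbit_norm[of "\<phi> \<theta>"] by (simp add: mult.assoc[symmetric] exp_add[symmetric])
      also have "\<dots> \<le> exp (r * \<tau>) * (exp (r * \<theta>) * orbit_norm (\<phi> \<theta>))"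
      proof (rule mult_right_mono)
        show "exp (- (r * \<theta>)) \<le> exp (r * \<tau>)"
          using mult_left_mono[of "- \<theta>" \<tau> r] \<theta> r by simp
      qed (simp add: orbit_norm_nonneg)
      also have "\<dots> \<le> exp (r * \<tau>) * weighted_norm \<tau> r \<phi>"
        using weighted_norm_upper[OF \<theta>] by (intro mult_left_mono) auto
      finally show "norm (\<phi> \<theta>) \<le> exp (r * \<tau>) * weighted_norm \<tau> r \<phi>" .
    qed (use \<tau> in simp)
    then show ?thesis by (simp add: exp_minus field_simps)
  qed
  show "weighted_norm \<tau> r \<phi> \<le> M * norm \<phi>" for \<phi> :: "real \<Rightarrow>\<^sub>C 'a" by (rule weighted_norm_le)
  show "weighted_norm \<tau> r (a *\<^sub>R \<phi>) \<le> \<bar>a\<bar> * weighted_norm \<tau> r \<phi>" for a and \<phi> :: "real \<Rightarrow>\<^sub>C 'a"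
  proof (rule weighted_norm_leI)
    fix \<theta> assume \<theta>: "\<theta> \<in> {- \<tau>..0}"
    have "exp (r * \<theta>) * orbit_norm ((a *\<^sub>R \<phi>) \<theta>) \<le> exp (r * \<theta>) * (\<bar>a\<bar> * orbit_norm (\<phi> \<theta>))"
      using orbit_norm_scaleR_le by (intro mult_left_mono) auto
    also have "\<dots> = \<bar>a\<bar> * (exp (r * \<theta>) * orbit_norm (\<phi> \<theta>))" by simp
    also have "\<dots> \<le> \<bar>a\<bar> * weighted_norm \<tau> r \<phi>"
      by (intro mult_left_mono weighted_norm_upper[OF \<theta>]) auto
    finally show "exp (r * \<theta>) * orbit_norm ((a *\<^sub>R \<phi>) \<theta>) \<le> \<bar>a\<bar> * weighted_norm \<tau> r \<phi>" .
  qed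
  show "weighted_norm \<tau> r (\<phi> + \<psi>) \<le> weighted_norm \<tau> r \<phi> + weighted_norm \<tau> r \<psi>" for \<phi> \<psi> :: "real \<Rightarrow>\<^sub>C 'a"
  proof (rule weighted_norm_leI)
    fix \<theta> assume \<theta>: "\<theta> \<in> {- \<tau>..0}"
    have "exp (r * \<theta>) * orbit_norm ((\<phi> + \<psi>) \<theta>) \<le> exp (r * \<theta>) * (orbit_norm (\<phi> \<theta>) + orbit_norm (\<psi> \<theta>))"
      using orbit_norm_add_le by (intro mult_left_mono) auto
    also have "\<dots> \<le> weighted_norm \<tau> r \<phi> + weighted_norm \<tau> r \<psi>"
      using weighted_norm_upper[OF \<theta>] by (simp add: distrib_left add_mono)
    finally show "exp (r * \<theta>) * orbit_norm ((\<phi> + \<psi>) \<theta>) \<le> weighted_norm \<tau> r \<phi> + weighted_norm \<tau> r \<psi>" .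
  qed
qed

text \<open>Where \<open>t + \<theta> \<le> 0\<close> the segment still shows the initial data and
  the weight supplies the decay. Otherwise, with \<open>s = t + \<theta>\<close>, the linear part
  carries \<open>exp (- r * s)\<close>, and the weight turns this into \<open>exp (- r * t)\<close>.
  The remainders contribute at most \<open>M * \<eta>\<close>.\<close>

lemma weighted_norm_segment_diff_le:
  fixes \<phi> \<psi> :: "real \<Rightarrow>\<^sub>C 'a"
  assumes t: "0 \<le> t" and C: "\<phi> \<in> C_space \<tau>" "\<psi> \<in> C_space \<tau>"
    and cont: "continuous_on {- \<tau>..} u" "continuous_on {- \<tau>..} v"
    and init: "\<And>\<theta>. \<theta> \<in> {- \<tau>..0} \<Longrightarrow> u \<theta> = \<phi> \<theta>" "\<And>\<theta>. \<theta> \<in> {- \<tau>..0} \<Longrightarrow> v \<theta> = \<psi> \<theta>"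
    and close: "\<And>s. s \<in> {0..t} \<Longrightarrow>
      norm ((u s - exp (- r * s) *\<^sub>R T s (\<phi> 0)) - (v s - exp (- r * s) *\<^sub>R T s (\<psi> 0))) \<le> \<eta>"
  shows "weighted_norm \<tau> r (segment \<tau> u t - segment \<tau> v t)
    \<le> exp (- r * t) * weighted_norm \<tau> r (\<phi> - \<psi>) + M * \<eta>"
proof (rule weighted_norm_leI)
  fix \<theta> assume \<theta>: "\<theta> \<in> {- \<tau>..0}"
  let ?W = "weighted_norm \<tau> r (\<phi> - \<psi>)"
  \<comment> \<open>The sign of \<eta> is read off from the closeness bound at time 0.\<close>
  have "0 \<le> \<eta>" using close[of 0] t norm_ge_zero by (meson atLeastAtMost_iff order_refl order_trans)
  then have M\<eta>: "0 \<le> M * \<eta>" using bound_nonneg by simp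
  have seg: "(segment \<tau> u t - segment \<tau> v t) \<theta> = u (t + \<theta>) - v (t + \<theta>)"
    using apply_segment[OF \<tau> cont(1) t \<theta>] apply_segment[OF \<tau> cont(2) t \<theta>] by simp
  show "exp (r * \<theta>) * orbit_norm ((segment \<tau> u t - segment \<tau> v t) \<theta>) \<le> exp (- r * t) * ?W + M * \<eta>"
  proof (cases "t + \<theta> \<le> 0")
    case True
    then have t\<theta>: "t + \<theta> \<in> {- \<tau>..0}" using \<theta> t by simp
    have "exp (r * \<theta>) * orbit_norm ((segment \<tau> u t - segment \<tau> v t) \<theta>)
        = exp (- r * t) * (exp (r * (t + \<theta>)) * orbit_norm ((\<phi> - \<psi>) (t + \<theta>)))"
    proof -
      have "exp (r * \<theta>) = exp (- r * t) * exp (r * (t + \<theta>))"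
        by (simp add: exp_add[symmetric] algebra_simps)
      moreover have "(segment \<tau> u t - segment \<tau> v t) \<theta> = (\<phi> - \<psi>) (t + \<theta>)"
        unfolding seg by (simp add: init[OF t\<theta>])
      ultimately show ?thesis by (simp only: mult.assoc)
    qed
    also have "\<dots> \<le> exp (- r * t) * ?W"
      by (intro mult_left_mono weighted_norm_upper[OF t\<theta>]) simp
    finally show ?thesis using M\<eta> by simp
  next
    case False
    define s where "s = t + \<theta>"
    have s: "s \<in> {0..t}" using False \<theta> by (simp add: s_def)
    \<comment> \<open>The difference of the two remainders. The linear part sees only
      \<open>(\<phi> - \<psi>) 0\<close>, where the weight is 1, so \<open>?W\<close> bounds its
      \<open>orbit_norm\<close> directly.\<close>
    define w where "w = (u s - exp (- r * s) *\<^sub>R T s (\<phi> 0)) - (v s - exp (- r * s) *\<^sub>R T s (\<psi> 0))"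
    have "u s - v s = exp (- r * s) *\<^sub>R T s ((\<phi> - \<psi>) 0) + w"
      by (simp add: w_def blinfun.diff_right scaleR_diff_right)
    then have "orbit_norm (u s - v s) \<le> orbit_norm (exp (- r * s) *\<^sub>R T s ((\<phi> - \<psi>) 0)) + orbit_norm w"
      using orbit_norm_add_le by simp
    also have "\<dots> \<le> exp (- r * s) * ?W + M * \<eta>"
    proof (rule add_mono)
      have "orbit_norm (exp (- r * s) *\<^sub>R T s ((\<phi> - \<psi>) 0)) \<le> exp (- r * s) * orbit_norm (T s ((\<phi> - \<psi>) 0))"
        using orbit_norm_scaleR_le[of "exp (- r * s)"] by simp
      also have "orbit_norm (T s ((\<phi> - \<psi>) 0)) \<le> orbit_norm ((\<phi> - \<psi>) 0)"
        using s by (intro orbit_norm_apply_le) simp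
      also have "orbit_norm ((\<phi> - \<psi>) 0) \<le> ?W"
        using weighted_norm_upper[of 0 "\<phi> - \<psi>"] \<tau> by simp
      finally show "orbit_norm (exp (- r * s) *\<^sub>R T s ((\<phi> - \<psi>) 0)) \<le> exp (- r * s) * ?W" by simp
      have "orbit_norm w \<le> M * norm w" by (rule orbit_norm_le)
      also have "\<dots> \<le> M * \<eta>" using close[OF s] bound_nonneg by (intro mult_left_mono) (auto simp: w_def)
      finally show "orbit_norm w \<le> M * \<eta>" .
    qed
    finally have "exp (r * \<theta>) * orbit_norm (u s - v s) \<le> exp (r * \<theta>) * (exp (- r * s) * ?W + M * \<eta>)"
      by (intro mult_left_mono) auto
    also have "\<dots> = exp (- r * t) * ?W + exp (r * \<theta>) * (M * \<eta>)"
      by (simp add: s_def distrib_left mult.assoc[symmetric] exp_add[symmetric])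
    also have "\<dots> \<le> exp (- r * t) * ?W + 1 * (M * \<eta>)"
      using \<theta> r M\<eta> by (intro add_left_mono mult_right_mono) (auto simp: mult_nonneg_nonpos)
    finally show ?thesis by (simp only: seg s_def)
  qed
qed

end

end

section \<open>The contraction estimate for the solution maps\<close>

theorem theoremA:
  fixes \<tau> M :: real
    and T :: "real \<Rightarrow> 'a::banach \<Rightarrow>\<^sub>L 'a"
    and D :: "'a set"
    and A :: "'a \<Rightarrow> 'a"
    and F :: "real \<Rightarrow> (real \<Rightarrow>\<^sub>C 'a) \<Rightarrow> 'a"
    and u :: "(real \<Rightarrow>\<^sub>C 'a) \<Rightarrow> real \<Rightarrow> 'a"
  assumes "\<tau> > 0"
    and "C0_semigroup T"
    and "infinitesimal_generator T D A"
    and "\<And>t. t > 0 \<Longrightarrow> compact_operator (T t)"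
    and "M > 0"
    and "\<And>t. t \<ge> 0 \<Longrightarrow> norm (T t) \<le> M"
    and "continuous_on ({0..} \<times> C_space \<tau>) (\<lambda>(t, \<phi>). F t \<phi>)"
    and "\<And>S. S \<subseteq> {0..} \<times> C_space \<tau> \<Longrightarrow> bounded S \<Longrightarrow> bounded ((\<lambda>(t, \<phi>). F t \<phi>) ` S)"
    and solution: "\<And>\<phi>. \<phi> \<in> C_space \<tau> \<Longrightarrow> mild_solution \<tau> T F \<phi> (u \<phi>)"
    and unique: "\<And>\<phi> v t. \<phi> \<in> C_space \<tau> \<Longrightarrow> mild_solution \<tau> T F \<phi> v \<Longrightarrow> t \<ge> - \<tau> \<Longrightarrow> v t = u \<phi> t"
    and uniformly_bounded: "\<And>B0. B0 \<subseteq> C_space \<tau> \<Longrightarrow> bounded B0 \<Longrightarrow>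
           \<exists>B1 \<subseteq> C_space \<tau>. bounded B1 \<and> (\<forall>\<phi>\<in>B0. \<forall>t\<ge>0. segment \<tau> (u \<phi>) t \<in> B1)"
  shows "\<forall>r>0. \<exists>N. equivalent_norm_on (C_space \<tau>) N \<and>
           (\<forall>B t. B \<subseteq> C_space \<tau> \<longrightarrow> bounded B \<longrightarrow> t \<ge> 0 \<longrightarrow>
              kuratowski (C_space \<tau>) N ((\<lambda>\<phi>. segment \<tau> (u \<phi>) t) ` B)
                \<le> exp (- r * t) * kuratowski (C_space \<tau>) N B)"
proof (intro allI impI)
  fix r :: real assume r: "r > 0"
  interpret compact_C0_semigroup T M
    using assms(2,4,6) by unfold_locales
  note \<tau> = \<open>\<tau> > 0\<close>
  \<comment> \<open>This norm depends only on \<tau>, \<open>r\<close> and \<open>T\<close>, so it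
    serves all \<open>B\<close> and \<open>t\<close> at once.\<close>
  define N where "N = weighted_norm \<tau> r"
  have cont: "continuous_on {- \<tau>..} (u \<phi>)"
    and init: "\<theta> \<in> {- \<tau>..0} \<Longrightarrow> u \<phi> \<theta> = \<phi> \<theta>" if "\<phi> \<in> C_space \<tau>" for \<phi> \<theta>
    using solution[OF that] by (auto simp: mild_solution_def)
  show "\<exists>N. equivalent_norm_on (C_space \<tau>) N \<and>
    (\<forall>B t. B \<subseteq> C_space \<tau> \<longrightarrow> bounded B \<longrightarrow> t \<ge> 0 \<longrightarrow>
      kuratowski (C_space \<tau>) N ((\<lambda>\<phi>. segment \<tau> (u \<phi>) t) ` B)
        \<le> exp (- r * t) * kuratowski (C_space \<tau>) N B)"
  proof (intro exI[of _ N] conjI allI impI)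
    show "equivalent_norm_on (C_space \<tau>) N"
      unfolding N_def by (rule equivalent_weighted_norm[OF \<tau> r])
    fix B :: "(real \<Rightarrow>\<^sub>C 'a) set" and t :: real
    assume B: "B \<subseteq> C_space \<tau>" "bounded B" and t: "t \<ge> 0"
    obtain b where b: "b > 0" "\<And>\<phi>. \<phi> \<in> B \<Longrightarrow> norm \<phi> \<le> b"
      using B(2) by (auto simp: bounded_pos)
    obtain B1 where B1: "B1 \<subseteq> C_space \<tau>" "bounded B1"
      "\<And>\<phi> s. \<phi> \<in> B \<Longrightarrow> s \<ge> 0 \<Longrightarrow> segment \<tau> (u \<phi>) s \<in> B1"
      using uniformly_bounded[OF B] by blast
    \<comment> \<open>All segments of solutions from \<open>B\<close> lie in \<open>B1\<close>, so
      \<open>F\<close> is bounded along them by one constant up to time \<open>t\<close>.\<close>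
    have "bounded ((\<lambda>(t, \<phi>). F t \<phi>) ` ({0..t} \<times> B1))"
      using B1 by (intro assms(8) bounded_Times) auto
    then obtain a where a: "a > 0" "\<And>s \<psi>. s \<in> {0..t} \<Longrightarrow> \<psi> \<in> B1 \<Longrightarrow> norm (F s \<psi>) \<le> a"
      by (fastforce simp: bounded_pos)
    define g where "g \<phi> s = u \<phi> s - exp (- r * s) *\<^sub>R T s (\<phi> 0)" for \<phi> s
    \<comment> \<open>The first summand bounds the convolution increment; the second comes from
      \<open>1 - exp (- r * h) \<le> r * h\<close>, the error caused by rescaling the
      semigroup.\<close>
    define c where "c = M * a + r * (M * b)"
    have g: "norm (g \<phi> (s + h) - T h (g \<phi> s)) \<le> c * h"
      if \<phi>: "\<phi> \<in> B" and sh: "0 \<le> s" "0 \<le> h" "s + h \<le> t" for \<phi> s h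
    proof -
      have "g \<phi> (s + h) - T h (g \<phi> s) = (u \<phi> (s + h) - T h (u \<phi> s))
          + (exp (- r * s) * (1 - exp (- r * h))) *\<^sub>R T (s + h) (\<phi> 0)"
      proof -
        have "exp (- r * (s + h)) = exp (- r * s) * exp (- r * h)"
          by (simp add: exp_add[symmetric] algebra_simps)
        moreover have "T h (T s (\<phi> 0)) = T (s + h) (\<phi> 0)"
          using add_apply[of h s "\<phi> 0"] sh by (simp add: add.commute)
        ultimately show ?thesis
          by (simp only: g_def blinfun.diff_right blinfun.scaleR_right) (simp add: algebra_simps)
      qed
      also have "norm \<dots> \<le> M * a * h + (1 * (r * h)) * (M * b)"
      proof (rule norm_triangle_le, rule add_mono)
        show "norm (u \<phi> (s + h) - T h (u \<phi> s)) \<le> M * a * h"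
          using \<phi> B(1) sh a(2) B1(3)
          by (intro mild_solution_increment[OF \<tau> solution assms(7)]) auto
        have "norm (T (s + h) (\<phi> 0)) \<le> M * norm (\<phi> 0)" using sh by (intro norm_apply_le) simp
        also have "\<dots> \<le> M * b"
          using norm_bounded[of \<phi> 0] b(2)[OF \<phi>] bound_nonneg by (intro mult_left_mono) auto
        finally have *: "norm (T (s + h) (\<phi> 0)) \<le> M * b" .
        have "1 - exp (- r * h) \<le> r * h" using exp_ge_add_one_self[of "- r * h"] by simp
        moreover have "exp (- r * h) \<le> 1" "exp (- r * s) \<le> 1" using r sh by auto
        ultimately have "exp (- r * s) * (1 - exp (- r * h)) \<le> 1 * (r * h)"
            "0 \<le> exp (- r * s) * (1 - exp (- r * h))"
          by (intro mult_mono mult_nonneg_nonneg; simp)+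
        then show "norm ((exp (- r * s) * (1 - exp (- r * h))) *\<^sub>R T (s + h) (\<phi> 0)) \<le> (1 * (r * h)) * (M * b)"
          unfolding norm_scaleR using * by (intro mult_mono) auto
      qed
      finally show ?thesis by (simp add: c_def algebra_simps)
    qed
    have c: "0 \<le> c" using a b r bound_nonneg by (simp add: c_def)
    have g0: "g \<phi> 0 = 0" if "\<phi> \<in> B" for \<phi>
      using init[of \<phi> 0] that B(1) \<tau> by (auto simp: g_def)
    have "\<exists>p :: (real \<Rightarrow>\<^sub>C 'a) \<Rightarrow> nat \<Rightarrow> 'a. finite (p ` B) \<and> (\<forall>\<phi>\<in>B. \<forall>\<psi>\<in>B. p \<phi> = p \<psi> \<longrightarrow>
        N (segment \<tau> (u \<phi>) t - segment \<tau> (u \<psi>) t) \<le> exp (- r * t) * N (\<phi> - \<psi>) + \<eta>)"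
      if "0 < \<eta>" for \<eta>
    proof -
      \<comment> \<open>Passing from \<open>norm\<close> to \<open>orbit_norm\<close> costs a factor
        \<open>M\<close>, which this choice absorbs.\<close>
      define \<eta>' where "\<eta>' = \<eta> / (M + 1)"
      have \<eta>': "0 < \<eta>'" "M * \<eta>' \<le> \<eta>"
        using that bound_nonneg by (auto simp: \<eta>'_def field_simps)
      obtain p :: "(real \<Rightarrow>\<^sub>C 'a) \<Rightarrow> nat \<Rightarrow> 'a" where p: "finite (p ` B)"
        "\<And>\<phi> \<psi> s. \<phi> \<in> B \<Longrightarrow> \<psi> \<in> B \<Longrightarrow> p \<phi> = p \<psi> \<Longrightarrow> s \<in> {0..t} \<Longrightarrow> norm (g \<phi> s - g \<psi> s) \<le> \<eta>'"
        using finite_partition_of_approximate_orbits[of B g t c \<eta>', OF g0 g c t \<eta>'(1)] by blast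
      have "N (segment \<tau> (u \<phi>) t - segment \<tau> (u \<psi>) t) \<le> exp (- r * t) * N (\<phi> - \<psi>) + \<eta>"
        if \<phi>\<psi>: "\<phi> \<in> B" "\<psi> \<in> B" "p \<phi> = p \<psi>" for \<phi> \<psi>
      proof -
        have C: "\<phi> \<in> C_space \<tau>" "\<psi> \<in> C_space \<tau>" using \<phi>\<psi> B(1) by auto
        have "N (segment \<tau> (u \<phi>) t - segment \<tau> (u \<psi>) t) \<le> exp (- r * t) * N (\<phi> - \<psi>) + M * \<eta>'"
          unfolding N_def
          by (rule weighted_norm_segment_diff_le[OF \<tau> r t C cont[OF C(1)] cont[OF C(2)]
                init[OF C(1)] init[OF C(2)] p(2)[OF \<phi>\<psi>, unfolded g_def]])
        then show ?thesis using \<eta>'(2) by simp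
      qed
      then show ?thesis using p(1) by blast
    qed
    then obtain p :: "real \<Rightarrow> (real \<Rightarrow>\<^sub>C 'a) \<Rightarrow> nat \<Rightarrow> 'a" where p:
      "\<And>\<eta>. 0 < \<eta> \<Longrightarrow> finite (p \<eta> ` B)"
      "\<And>\<eta> \<phi> \<psi>. 0 < \<eta> \<Longrightarrow> \<phi> \<in> B \<Longrightarrow> \<psi> \<in> B \<Longrightarrow> p \<eta> \<phi> = p \<eta> \<psi> \<Longrightarrow>
        N (segment \<tau> (u \<phi>) t - segment \<tau> (u \<psi>) t) \<le> exp (- r * t) * N (\<phi> - \<psi>) + \<eta>"
      by metis
    \<comment> \<open>This finite diameter bound makes \<open>B\<close> its own admissible cover;
      the summand 1 makes the bound positive.\<close>
    have "diameter_wrt N B \<le> ennreal (M * (b + b) + 1)"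
      unfolding diameter_wrt_def
    proof (intro SUP_least ennreal_leI)
      fix \<phi> \<psi> assume "\<phi> \<in> B" "\<psi> \<in> B"
      then have "norm (\<phi> - \<psi>) \<le> b + b"
        using b(2) by (intro norm_triangle_le_diff add_mono)
      then have "M * norm (\<phi> - \<psi>) \<le> M * (b + b)" using bound_nonneg by (rule mult_left_mono)
      then show "N (\<phi> - \<psi>) \<le> M * (b + b) + 1"
        using weighted_norm_le[OF \<tau> r, of "\<phi> - \<psi>"] by (simp add: N_def)
    qed
    moreover have "0 < M * (b + b) + 1"
      using b(1) bound_nonneg by (intro add_nonneg_pos) auto
    moreover have "(\<lambda>\<phi>. segment \<tau> (u \<phi>) t) ` B \<subseteq> C_space \<tau>"
      using segment_mem[OF \<tau> cont t] B(1) by blast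
    ultimately show "kuratowski (C_space \<tau>) N ((\<lambda>\<phi>. segment \<tau> (u \<phi>) t) ` B)
        \<le> exp (- r * t) * kuratowski (C_space \<tau>) N B"
      using B(1) p by (intro kuratowski_image_le[where p = p]) auto
  qed
qed

end
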